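(* Let $M$ and $N$ be compact metric spaces, $\Pi\in\mathcal P(N)$, and let $G^E:N\times M\to(-\infty,\infty]$ and $G^I:N\to(-\infty,\infty]$ be lower semicontinuous. Let $\{\nu_n\}_{n\in\mathbb N}$ be a sequence in $\mathcal P(M)$ converging to $\nu\in\mathcal P(M)$ and let $\{\lambda_n\}_{n\in\mathbb N}$ be a sequence that converges to zero. Define $V_n:N\to(-\infty,\infty]$ by $V_n(x)=\int_MG^E(x,y)\,d\nu_n(y)$. Suppose that $V:N\to\mathbb R$ defined by $V(x)=\int_MG^E(x,y)\,d\nu(y)$ is (bounded and) continuous. Let $$\tilde{\mathcal N}=\Big\{\mu\in\mathcal P(N):D(\mu\|\Pi)<\infty,\ \int_NG^I\,d\mu<\infty\text{ and }y\mapsto\int_NG^E(x,y)\,d\mu(x)\text{ is continuous}\Big\}$$ and suppose that for every $z\in N$ there exists a sequence $\{\mu_n\}_{n\in\mathbb N}$ in $\tilde{\mathcal N}$ such that $\mu_n\to\delta_z$. Let $\{\beta_n\}_{n\in\mathbb N}$ be a sequence of non-negative numbers with $\beta_n\to\infty$ and define the measures $\gamma^c_n$ on $N$ by $d\gamma^c_n=e^{-\beta_n(V_n+\lambda_nG^I)}\,d\Pi$. Then for every (bounded) continuous function $f:N\to\mathbb R$, $$\frac1{\beta_n}\log\int_Ne^{-\beta_nf}\,d\gamma^c_n\ \xrightarrow[n\to\infty]{}\ -\inf_{x\in N}\{f(x)+V(x)\}.$$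
   Context: $\mathcal P(X)$ is the space of Borel probability measures on $X$ with the weak topology, and convergence of measures is weak convergence. $D(\mu\|\Pi)=\int\frac{d\mu}{d\Pi}\log\frac{d\mu}{d\Pi}\,d\Pi$ if $\mu\ll\Pi$ and $\infty$ otherwise.
   Formalization: The λ_n are assumed non-negative (for negative λ_n the claim fails, e.g. G^E=0, G^I(x)=1/x on [0,1], λ_n=-1/n, β_n=n), and "continuous" in the definition of Ñ means finite everywhere and continuous as a real-valued function. *)

theory Defs
  imports "HOL-Probability.Probability"
begin

definition borel_prob :: "'a::topological_space measure set" where
  "borel_prob = {\<mu>. prob_space \<mu> \<and> sets \<mu> = sets borel}"

text \<open>The library's \<open>weak_conv_m\<close> is restricted to measures on the real line.\<close>

definition weakly_converges ::
    "(nat \<Rightarrow> 'a::topological_space measure) \<Rightarrow> 'a measure \<Rightarrow> bool" where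
  "weakly_converges \<mu>s \<mu> \<longleftrightarrow>
     (\<forall>g::'a \<Rightarrow> real. continuous_on UNIV g \<and> bounded (range g) \<longrightarrow>
        (\<lambda>n. \<integral>x. g x \<partial>\<mu>s n) \<longlonglongrightarrow> (\<integral>x. g x \<partial>\<mu>))"

definition lower_semicontinuous :: "('a::topological_space \<Rightarrow> ereal) \<Rightarrow> bool" where
  "lower_semicontinuous h \<longleftrightarrow> (\<forall>a. open {x. a < h x})"

text \<open>Lebesgue integral of an extended real function: integral of the positive part minus
  integral of the negative part (\<open>e2ennreal\<close> sends negative numbers to 0).  It is meaningful
  when one of the two is finite, in particular when the function is bounded from below and the
  measure is finite; since \<open>\<infinity> - \<infinity> = \<infinity>\<close> in \<open>ereal\<close>, the remaining case
  has value \<open>\<infinity>\<close>.\<close>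

definition ereal_integral :: "'a measure \<Rightarrow> ('a \<Rightarrow> ereal) \<Rightarrow> ereal" where
  "ereal_integral \<mu> h =
     enn2ereal (\<integral>\<^sup>+ x. e2ennreal (h x) \<partial>\<mu>) - enn2ereal (\<integral>\<^sup>+ x. e2ennreal (- h x) \<partial>\<mu>)"

text \<open>\<open>D(\<mu> \<parallel> P)\<close>.  The library's \<open>KL_divergence\<close> is real valued and therefore cannot
  take the value \<open>\<infinity>\<close>.  The convention \<open>0 log 0 = 0\<close> is built into \<open>0 * ln 0 = 0\<close>;
  the density is finite almost everywhere, so \<open>enn2real\<close> loses nothing.\<close>

definition relative_entropy :: "'a measure \<Rightarrow> 'a measure \<Rightarrow> ereal" where
  "relative_entropy \<mu> P =
     (if absolutely_continuous P \<mu>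
      then ereal_integral P
             (\<lambda>x. ereal (enn2real (RN_deriv P \<mu> x) * ln (enn2real (RN_deriv P \<mu> x))))
      else \<infinity>)"

definition exp_ereal :: "ereal \<Rightarrow> ennreal" where
  "exp_ereal u = (case u of ereal r \<Rightarrow> ennreal (exp r) | PInfty \<Rightarrow> \<infinity> | MInfty \<Rightarrow> 0)"

definition ln_ennreal :: "ennreal \<Rightarrow> ereal" where
  "ln_ennreal u = (if u = 0 then -\<infinity> else if u = \<infinity> then \<infinity> else ereal (ln (enn2real u)))"

text \<open>The set of test measures.  The function \<open>y \<mapsto> \<integral> GE (x, y) d\<mu>(x)\<close> is
  required to be finite everywhere and continuous as a real function.  Mere continuity into
  \<open>(-\<infinity>, \<infinity>]\<close> would not do: it allows poles of this function that are charged by the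
  \<open>\<nu>\<^sub>n\<close> but not by their limit.\<close>

definition tilde_N ::
    "'n::topological_space measure \<Rightarrow> ('n \<times> 'm::topological_space \<Rightarrow> ereal) \<Rightarrow> ('n \<Rightarrow> ereal)
       \<Rightarrow> 'n measure set" where
  "tilde_N P GE GI =
     {\<mu> \<in> borel_prob.
        relative_entropy \<mu> P < \<infinity> \<and>
        ereal_integral \<mu> GI < \<infinity> \<and>
        (\<exists>h::'m \<Rightarrow> real. continuous_on UNIV h \<and>
           (\<forall>y. ereal_integral \<mu> (\<lambda>x. GE (x, y)) = ereal (h y)))}"

definition potential :: "('n \<times> 'm \<Rightarrow> ereal) \<Rightarrow> 'm measure \<Rightarrow> 'n \<Rightarrow> ereal" where
  "potential GE \<nu> x = ereal_integral \<nu> (\<lambda>y. GE (x, y))"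

text \<open>The measure with density \<open>exp (- b (W + l GI))\<close> with respect to \<open>P\<close>.  For
  \<open>l \<ge> 0\<close> and \<open>W, GI > -\<infinity>\<close> the sum never has the form \<open>\<infinity> - \<infinity>\<close>; note that
  \<open>0 * \<infinity> = 0\<close> in \<open>ereal\<close>.\<close>

definition gibbs_measure ::
    "'n measure \<Rightarrow> real \<Rightarrow> ('n \<Rightarrow> ereal) \<Rightarrow> real \<Rightarrow> ('n \<Rightarrow> ereal) \<Rightarrow> 'n measure" where
  "gibbs_measure P b W l GI =
     density P (\<lambda>x. exp_ereal (- (ereal b * (W x + ereal l * GI x))))"

end

theory Submission
  imports Defs
begin

text \<open>Lower bound on the limit: for a test measure \<open>\<mu>\<close> close to \<open>\<delta>\<^sub>z\<close>, with \<open>z\<close> a minimiser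
  of \<open>f + V\<close>, the Gibbs variational inequality bounds \<open>1 / \<beta>\<^sub>n\<close> times the log-integral below by
  \<open>- \<integral> (f + V\<^sub>n + \<lambda>\<^sub>n G\<^sup>I) d\<mu> - D(\<mu> \<parallel> \<Pi>) / \<beta>\<^sub>n\<close>; by Tonelli \<open>\<integral> V\<^sub>n d\<mu>\<close> is the
  \<open>\<nu>\<^sub>n\<close>-integral of a continuous function, so it converges to \<open>\<integral> V d\<mu>\<close>.

  Upper bound on the limit: \<open>G\<^sup>E\<close> is the pointwise limit of Lipschitz minorants, and those together
  with continuity of \<open>V\<close> and compactness of \<open>N\<close> give \<open>V\<^sub>n \<ge> V - \<epsilon>\<close> everywhere for large \<open>n\<close>,
  so the integrand is bounded pointwise.\<close>

section \<open>Extended real integrals of functions bounded below\<close>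

text \<open>The decomposition of \<open>u\<close> into positive and negative part, rearranged so
  that only sums occur: subtraction in \<open>ennreal\<close> truncates. The lower bound on
  \<open>u\<close> makes \<open>u + ereal C\<close> nonnegative, so \<open>e2ennreal\<close> cuts
  nothing off there.\<close>

lemma e2ennreal_shift:
  assumes "- ereal C \<le> u" "0 \<le> C"
  shows "e2ennreal (u + ereal C) + e2ennreal (- u) = e2ennreal u + ennreal C"
proof (cases u)
  case (real r)
  show ?thesis
  proof (cases "r \<ge> 0")
    case True
    then show ?thesis using real assms by (simp add: ennreal_neg)
  next
    case False
    then show ?thesis using real assms
      by (simp add: ennreal_neg flip: ennreal_plus)
  qed
qed (use assms in \<open>auto\<close>)

text \<open>Reduces the signed integral to a nonnegative one, for which Tonelli and measurability of
  inner integrals hold unconditionally. The total mass 1 is what makes the constant come out as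
  exactly \<open>C\<close>.\<close>

lemma ereal_integral_shift:
  assumes "prob_space \<mu>" and [measurable]: "h \<in> borel_measurable \<mu>"
    and bnd: "\<And>x. - ereal C \<le> h x" and "0 \<le> C"
  shows "ereal_integral \<mu> h + ereal C = enn2ereal (\<integral>\<^sup>+ x. e2ennreal (h x + ereal C) \<partial>\<mu>)"
proof -
  interpret prob_space \<mu> by fact
  define I A B where "I = (\<integral>\<^sup>+ x. e2ennreal (h x + ereal C) \<partial>\<mu>)"
    and "A = (\<integral>\<^sup>+ x. e2ennreal (h x) \<partial>\<mu>)" and "B = (\<integral>\<^sup>+ x. e2ennreal (- h x) \<partial>\<mu>)"
  have "I + B = (\<integral>\<^sup>+ x. e2ennreal (h x + ereal C) + e2ennreal (- h x) \<partial>\<mu>)"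
    unfolding I_def B_def by (rule nn_integral_add[symmetric]) measurable
  also have "\<dots> = (\<integral>\<^sup>+ x. e2ennreal (h x) + ennreal C \<partial>\<mu>)"
    using bnd \<open>0 \<le> C\<close> by (simp add: e2ennreal_shift)
  also have "\<dots> = A + ennreal C"
    unfolding A_def by (subst nn_integral_add) (auto simp: emeasure_space_1)
  finally have eq: "I + B = A + ennreal C" .
  \<comment> \<open>The negative part is at most \<open>C\<close>, so its integral is finite and can
    be cancelled in \<open>ereal\<close>.\<close>
  have "B \<le> (\<integral>\<^sup>+ x. ennreal C \<partial>\<mu>)"
    unfolding B_def
  proof (rule nn_integral_mono)
    fix x show "e2ennreal (- h x) \<le> ennreal C"
      using e2ennreal_mono[of "- h x" "ereal C"] bnd[of x] by (simp add: ereal_uminus_le_reorder)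
  qed
  also have "\<dots> = ennreal C" by (simp add: emeasure_space_1)
  finally have "B < \<infinity>" by (simp add: le_less_trans)
  then obtain b where b: "B = ennreal b" "b \<ge> 0" by (cases B) auto
  have "enn2ereal I + ereal b = enn2ereal A + ereal C"
    using arg_cong[OF eq, of enn2ereal] b \<open>0 \<le> C\<close> by (simp add: plus_ennreal.rep_eq)
  then have "enn2ereal A - ereal b + ereal C = enn2ereal I"
    by (cases "enn2ereal A"; cases "enn2ereal I") auto
  then show ?thesis
    unfolding ereal_integral_def A_def[symmetric] B_def[symmetric] I_def[symmetric]
    using b by simp
qed

lemma ereal_integral_lower_bound:
  assumes "prob_space \<mu>" "h \<in> borel_measurable \<mu>" "\<And>x. - ereal C \<le> h x" "0 \<le> C"
  shows "- ereal C \<le> ereal_integral \<mu> h"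
proof -
  have "0 \<le> ereal_integral \<mu> h + ereal C"
    by (simp add: ereal_integral_shift[OF assms])
  then show ?thesis by (cases "ereal_integral \<mu> h") auto
qed

lemma ereal_integral_mono:
  assumes "\<And>x. h x \<le> h' x"
  shows "ereal_integral \<mu> h \<le> ereal_integral \<mu> h'"
  unfolding ereal_integral_def using assms
  by (intro ereal_minus_mono) (auto simp flip: less_eq_ennreal.rep_eq intro!: nn_integral_mono e2ennreal_mono)

lemma ereal_integral_eq_integral:
  fixes h :: "'a \<Rightarrow> real"
  assumes "integrable \<mu> h"
  shows "ereal_integral \<mu> (\<lambda>x. ereal (h x)) = ereal (\<integral>x. h x \<partial>\<mu>)"
proof -
  have "(\<integral>\<^sup>+ x. ennreal (h x) \<partial>\<mu>) \<noteq> \<infinity>" "(\<integral>\<^sup>+ x. ennreal (- h x) \<partial>\<mu>) \<noteq> \<infinity>"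
    using assms by (auto simp: real_integrable_def)
  then show ?thesis
    unfolding ereal_integral_def real_lebesgue_integral_def[OF assms]
    by (cases "\<integral>\<^sup>+ x. ennreal (h x) \<partial>\<mu>"; cases "\<integral>\<^sup>+ x. ennreal (- h x) \<partial>\<mu>") auto
qed

text \<open>The passage to Bochner integrals: after the shift by \<open>C\<close> the integrand is
  nonnegative with finite integral, hence finite almost everywhere, and replacing the value
  \<infinity> by 0 through \<open>real_of_ereal\<close> changes it only on a null set.\<close>

lemma ereal_integral_finite:
  assumes "prob_space \<mu>" and [measurable]: "h \<in> borel_measurable \<mu>"
    and bnd: "\<And>x. - ereal C \<le> h x" and "0 \<le> C"
    and fin: "ereal_integral \<mu> h < \<infinity>"
  shows "AE x in \<mu>. h x = ereal (real_of_ereal (h x))"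
    and "integrable \<mu> (\<lambda>x. real_of_ereal (h x))"
    and "ereal_integral \<mu> h = ereal (\<integral>x. real_of_ereal (h x) \<partial>\<mu>)"
proof -
  interpret prob_space \<mu> by fact
  have "enn2ereal (\<integral>\<^sup>+ x. e2ennreal (h x + ereal C) \<partial>\<mu>) \<noteq> \<infinity>"
    using ereal_integral_shift[OF assms(1-4)] fin by (cases "ereal_integral \<mu> h") auto
  then have nfin: "(\<integral>\<^sup>+ x. e2ennreal (h x + ereal C) \<partial>\<mu>) \<noteq> \<infinity>"
    by auto
  then have "AE x in \<mu>. e2ennreal (h x + ereal C) \<noteq> \<infinity>"
    by (intro nn_integral_noteq_infinite) auto
  then show ae: "AE x in \<mu>. h x = ereal (real_of_ereal (h x))"
  proof eventually_elim
    case (elim x)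
    then show ?case using bnd[of x] by (cases "h x") auto
  qed
  have "integrable \<mu> (\<lambda>x. real_of_ereal (h x) + C)"
  proof (rule integrableI_nonneg)
    show "AE x in \<mu>. 0 \<le> real_of_ereal (h x) + C"
      using ae
    proof eventually_elim
      case (elim x)
      then show ?case using bnd[of x] by (cases "h x") auto
    qed
    have "(\<integral>\<^sup>+ x. ennreal (real_of_ereal (h x) + C) \<partial>\<mu>) = (\<integral>\<^sup>+ x. e2ennreal (h x + ereal C) \<partial>\<mu>)"
    proof (rule nn_integral_cong_AE, use ae in eventually_elim)
      case (elim x)
      then show ?case by (cases "h x") auto
    qed
    then show "(\<integral>\<^sup>+ x. ennreal (real_of_ereal (h x) + C) \<partial>\<mu>) < \<infinity>"
      using nfin by (simp add: less_top)
  qed measurable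
  then have "integrable \<mu> (\<lambda>x. (real_of_ereal (h x) + C) - C)"
    by (intro Bochner_Integration.integrable_diff) auto
  then show int: "integrable \<mu> (\<lambda>x. real_of_ereal (h x))" by simp
  have "ereal_integral \<mu> h = ereal_integral \<mu> (\<lambda>x. ereal (real_of_ereal (h x)))"
    unfolding ereal_integral_def
    by (intro arg_cong2[where f = "(-)"] arg_cong[where f = enn2ereal] nn_integral_cong_AE;
        use ae in eventually_elim) auto
  also have "\<dots> = ereal (\<integral>x. real_of_ereal (h x) \<partial>\<mu>)"
    by (rule ereal_integral_eq_integral[OF int])
  finally show "ereal_integral \<mu> h = ereal (\<integral>x. real_of_ereal (h x) \<partial>\<mu>)" .
qed

section \<open>Lower semicontinuous functions: measurability and lower bounds\<close>

lemma lower_semicontinuous_measurable: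
  assumes "lower_semicontinuous h" "sets \<mu> = sets borel"
  shows "h \<in> borel_measurable \<mu>"
  using assms
  unfolding measurable_cong_sets[OF assms(2) refl]
  by (simp add: lower_semicontinuous_def borel_measurable_ereal_iff_Ioi vimage_def)

text \<open>The sets where \<open>h\<close> exceeds \<open>- real c\<close> are open, grow with
  \<open>c\<close> and cover the space since \<open>h\<close> avoids -\<infinity>; the largest index
  of a finite subcover gives the bound.\<close>

lemma lower_semicontinuous_bounded_below:
  fixes h :: "'a::topological_space \<Rightarrow> ereal"
  assumes "compact (UNIV :: 'a set)" "lower_semicontinuous h" "\<And>x. h x > -\<infinity>"
  obtains C :: real where "0 \<le> C" "\<And>x. - ereal C \<le> h x"
proof -
  have "\<And>c. c \<in> (UNIV::nat set) \<Longrightarrow> open {x. ereal (- real c) < h x}"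
    using assms(2) by (simp add: lower_semicontinuous_def)
  moreover have "(UNIV :: 'a set) \<subseteq> (\<Union>c\<in>(UNIV::nat set). {x. ereal (- real c) < h x})"
  proof
    fix x
    show "x \<in> (\<Union>c\<in>(UNIV::nat set). {x. ereal (- real c) < h x})"
    proof (cases "h x")
      case (real r)
      obtain n :: nat where "- r < real n" using reals_Archimedean2 by blast
      then show ?thesis using real by (auto intro!: exI[of _ n])
    qed (use assms(3)[of x] in auto)
  qed
  ultimately obtain F where F: "finite F" "UNIV \<subseteq> (\<Union>c\<in>F. {x. ereal (- real c) < h x})"
    by (metis (no_types, lifting) compactE_image[OF assms(1)])
  show thesis
  proof (rule that[of "real (Max (insert 0 F))"])
    fix x :: 'a
    from F(2) obtain c where "c \<in> F" "ereal (- real c) < h x" by auto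
    moreover have "c \<le> Max (insert 0 F)" using F(1) \<open>c \<in> F\<close> by simp
    ultimately show "- ereal (real (Max (insert 0 F))) \<le> h x"
      by (cases "h x") auto
  qed simp
qed

section \<open>Exponential and logarithm on extended values\<close>

lemma exp_ereal_alt:
  "exp_ereal u = (if u = \<infinity> then \<infinity> else if u = -\<infinity> then 0 else ennreal (exp (real_of_ereal u)))"
  by (cases u) (auto simp: exp_ereal_def)

lemma exp_ereal_measurable [measurable]: "exp_ereal \<in> borel_measurable borel"
  unfolding exp_ereal_alt[abs_def] by measurable

lemma exp_ereal_mono: "u \<le> v \<Longrightarrow> exp_ereal u \<le> exp_ereal v"
  by (cases u; cases v) (auto simp: exp_ereal_def ennreal_leI)

lemma exp_ereal_ereal [simp]: "exp_ereal (ereal r) = ennreal (exp r)"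
  by (simp add: exp_ereal_def)

lemma ln_ennreal_le:
  assumes "u \<le> ennreal (exp r)"
  shows "ln_ennreal u \<le> ereal r"
proof (cases u)
  case (real s)
  then show ?thesis
  proof (cases "s = 0")
    case False
    then have "ln s \<le> ln (exp r)"
      using real assms by (subst ln_le_cancel_iff) auto
    then show ?thesis using real False by (simp add: ln_ennreal_def)
  qed (simp add: ln_ennreal_def)
qed (use assms in \<open>auto simp: top_unique\<close>)

lemma ln_ennreal_ge:
  assumes "ennreal (exp r) \<le> u"
  shows "ereal r \<le> ln_ennreal u"
proof (cases u)
  case (real s)
  then have "exp r \<le> s" using assms by simp
  moreover from this have "0 < s" by (rule less_le_trans[OF exp_gt_zero])
  ultimately show ?thesis using real by (simp add: ln_ennreal_def ln_ge_iff)
qed (simp add: ln_ennreal_def)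

section \<open>Sections and joint measurability on the product\<close>

lemma lower_semicontinuous_section:
  assumes "lower_semicontinuous G"
  shows "lower_semicontinuous (\<lambda>y. G (x, y))" "lower_semicontinuous (\<lambda>x. G (x, y))"
proof -
  have "open (Pair x -` {p. a < G p})" "open ((\<lambda>x. (x, y)) -` {p. a < G p})" for a
    using assms unfolding lower_semicontinuous_def
    by - (intro open_vimage continuous_intros; simp)+
  then show "lower_semicontinuous (\<lambda>y. G (x, y))" "lower_semicontinuous (\<lambda>x. G (x, y))"
    by (simp_all add: lower_semicontinuous_def vimage_def)
qed

lemma compact_finite_net:
  fixes d :: real
  assumes "compact (UNIV :: 'a::metric_space set)" "0 < d"
  obtains F :: "'a::metric_space set" where "finite F" "\<And>x. \<exists>a\<in>F. dist a x < d"
  using assms unfolding compact_eq_totally_bounded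
  by (metis UN_iff UNIV_I mem_ball subset_iff)

text \<open>An open set lies in the product sigma-algebra if it is a countable union of open
  rectangles. Compactness provides the countable base: balls of radius \<open>d k\<close> around the
  points of finite \<open>d k\<close>-nets.\<close>

lemma open_in_sets_pair_borel:
  fixes U :: "('a::metric_space \<times> 'b::metric_space) set"
  assumes "compact (UNIV :: 'a set)" "compact (UNIV :: 'b set)" "open U"
  shows "U \<in> sets (borel \<Otimes>\<^sub>M borel)"
proof -
  define d where "d k = 1 / real (Suc k)" for k
  have "d k > 0" for k by (simp add: d_def)
  then have "\<exists>F :: 'a set. finite F \<and> (\<forall>x. \<exists>a\<in>F. dist a x < d k)"
    and "\<exists>F :: 'b set. finite F \<and> (\<forall>x. \<exists>a\<in>F. dist a x < d k)" for k
    by (metis compact_finite_net[OF assms(1)], metis compact_finite_net[OF assms(2)])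
  then obtain A :: "nat \<Rightarrow> 'a set" and B :: "nat \<Rightarrow> 'b set"
    where A: "\<And>k. finite (A k)" "\<And>k x. \<exists>a\<in>A k. dist a x < d k"
      and B: "\<And>k. finite (B k)" "\<And>k y. \<exists>b\<in>B k. dist b y < d k"
    by metis
  define I where "I = {i \<in> Sigma UNIV (\<lambda>k. A k \<times> B k).
    ball (fst (snd i)) (d (fst i)) \<times> ball (snd (snd i)) (d (fst i)) \<subseteq> U}"
  have "countable I"
    unfolding I_def using A(1) B(1)
    by (intro countable_subset[OF Collect_restrict] countable_SIGMA) (auto intro: countable_finite)
  moreover have U: "U = (\<Union>i\<in>I. ball (fst (snd i)) (d (fst i)) \<times> ball (snd (snd i)) (d (fst i)))"
  proof (intro equalityI subsetI)
    fix p assume "p \<in> U"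
    then obtain S T where ST: "open S" "open T" "p \<in> S \<times> T" "S \<times> T \<subseteq> U"
      using open_prod_elim[OF \<open>open U\<close>] by metis
    obtain x y where p: "p = (x, y)" by (cases p)
    from ST p obtain e1 e2 where e: "e1 > 0" "ball x e1 \<subseteq> S" "e2 > 0" "ball y e2 \<subseteq> T"
      by (metis open_contains_ball mem_Sigma_iff)
    \<comment> \<open>Half the radius suffices: a net point is within \<open>d k\<close> of
      \<open>x\<close>, so its ball of radius \<open>d k\<close> stays within \<open>2 * d k\<close>
      of \<open>x\<close>; likewise for \<open>y\<close>.\<close>
    then obtain k where "d k < min e1 e2 / 2"
      using reals_Archimedean[of "min e1 e2 / 2"] by (auto simp: d_def inverse_eq_divide)
    then have k: "2 * d k < e1" "2 * d k < e2" by auto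
    obtain a b where ab: "a \<in> A k" "dist a x < d k" "b \<in> B k" "dist b y < d k"
      using A(2) B(2) by metis
    have "ball a (d k) \<subseteq> ball x e1"
    proof
      fix w assume "w \<in> ball a (d k)"
      then show "w \<in> ball x e1"
        using ab(2) k(1) dist_triangle[of x w a] by (simp add: dist_commute)
    qed
    moreover have "ball b (d k) \<subseteq> ball y e2"
    proof
      fix w assume "w \<in> ball b (d k)"
      then show "w \<in> ball y e2"
        using ab(4) k(2) dist_triangle[of y w b] by (simp add: dist_commute)
    qed
    ultimately have "ball a (d k) \<times> ball b (d k) \<subseteq> U" using e ST by blast
    then have "(k, a, b) \<in> I" using ab by (simp add: I_def)
    then show "p \<in> (\<Union>i\<in>I. ball (fst (snd i)) (d (fst i)) \<times> ball (snd (snd i)) (d (fst i)))"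
      using ab p by (intro UN_I[of "(k, a, b)"]) auto
  qed (auto simp: I_def)
  moreover have "ball a c \<times> ball b c \<in> sets (borel \<Otimes>\<^sub>M borel)" for a :: 'a and b :: 'b and c
    by (intro pair_measureI) auto
  ultimately show ?thesis
    by (subst U) (intro sets.countable_UN'')
qed

lemma lower_semicontinuous_measurable_pair:
  fixes G :: "'a::metric_space \<times> 'b::metric_space \<Rightarrow> ereal"
  assumes "compact (UNIV :: 'a set)" "compact (UNIV :: 'b set)" "lower_semicontinuous G"
  shows "G \<in> borel_measurable (borel \<Otimes>\<^sub>M borel)"
  using open_in_sets_pair_borel[OF assms(1,2)] assms(3)
  by (simp add: lower_semicontinuous_def borel_measurable_ereal_iff_Ioi vimage_def space_pair_measure)

lemma integrable_continuous_compact: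
  fixes g :: "'a::metric_space \<Rightarrow> real"
  assumes "compact (UNIV :: 'a set)" "\<mu> \<in> borel_prob" "continuous_on UNIV g"
  shows "integrable \<mu> g"
proof -
  interpret prob_space \<mu> using assms(2) by (simp add: borel_prob_def)
  have "bounded (range g)"
    by (intro compact_imp_bounded compact_continuous_image assms)
  then obtain B where "\<And>x. norm (g x) \<le> B" by (auto simp: bounded_iff)
  moreover have "g \<in> borel_measurable \<mu>"
    using borel_measurable_continuous_onI[OF assms(3)] assms(2)
    by (simp add: borel_prob_def cong: measurable_cong_sets)
  ultimately show ?thesis by (intro integrable_const_bound) auto
qed


section \<open>Lipschitz approximation from below\<close>

text \<open>The infimal convolution (Pasch-Hausdorff envelope) of a truncation of \<open>G\<close>
  with \<open>k\<close> times the distance. Truncating at \<open>k\<close> keeps the values real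
  even where \<open>G\<close> is infinite.\<close>

definition lipschitz_minorant :: "('a::metric_space \<Rightarrow> ereal) \<Rightarrow> nat \<Rightarrow> 'a \<Rightarrow> real" where
  "lipschitz_minorant G k p =
     (INF q. real_of_ereal (min (G q) (ereal (real k))) + real k * dist p q)"

context
  fixes G :: "'a::metric_space \<Rightarrow> ereal" and C :: real
  assumes bnd: "\<And>p. - ereal C \<le> G p" and C: "0 \<le> C"
begin

lemma truncation_ge: "- C \<le> real_of_ereal (min (G q) (ereal (real k)))"
  using bnd[of q] C by (cases "G q") (auto simp: min_def)

lemma lipschitz_minorant_ge: "- C \<le> lipschitz_minorant G k p"
  unfolding lipschitz_minorant_def
  using truncation_ge by (intro cINF_greatest) (auto simp: add_increasing2)

lemma lipschitz_minorant_lower: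
  "lipschitz_minorant G k p \<le> real_of_ereal (min (G q) (ereal (real k))) + real k * dist p q"
  unfolding lipschitz_minorant_def
  using truncation_ge by (intro cINF_lower bdd_belowI[of _ "- C"]) (auto simp: add_increasing2)

lemma lipschitz_minorant_le: "ereal (lipschitz_minorant G k p) \<le> G p"
  using lipschitz_minorant_lower[of k p p] bnd[of p] by (cases "G p") (auto simp: min_def split: if_splits)

text \<open>Each function under the infimum is \<open>k\<close>-Lipschitz in the point, by the
  triangle inequality, and an infimum inherits this.\<close>

lemma lipschitz_minorant_dist:
  "lipschitz_minorant G k p - real k * dist p p' \<le> lipschitz_minorant G k p'"
proof -
  have "lipschitz_minorant G k p - real k * dist p p'
      \<le> real_of_ereal (min (G q) (ereal (real k))) + real k * dist p' q" for q
  proof -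
    have "real k * dist p q \<le> real k * dist p p' + real k * dist p' q"
      by (metis dist_triangle distrib_left mult_left_mono of_nat_0_le_iff)
    then show ?thesis using lipschitz_minorant_lower[of k p q] by simp
  qed
  then show ?thesis
    unfolding lipschitz_minorant_def[of G k p'] by (intro cINF_greatest) auto
qed

lemma continuous_on_lipschitz_minorant: "continuous_on A (lipschitz_minorant G k)"
proof (rule lipschitz_on_continuous_on)
  show "lipschitz_on (real k) A (lipschitz_minorant G k)"
  proof (rule lipschitz_onI)
    fix p p'
    show "dist (lipschitz_minorant G k p) (lipschitz_minorant G k p') \<le> real k * dist p p'"
      using lipschitz_minorant_dist[of k p p'] lipschitz_minorant_dist[of k p' p]
      by (simp add: dist_real_def dist_commute)
  qed simp
qed

text \<open>Near \<open>p\<close> semicontinuity keeps \<open>G\<close> above any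
  \<open>a < r\<close>; away from \<open>p\<close> the distance penalty outweighs the lower bound
  \<open>- C\<close>. Finite values of \<open>G p\<close> are enough for use under an integral that
  is finite.\<close>

lemma lipschitz_minorant_tendsto:
  assumes lsc: "lower_semicontinuous G" and r: "G p = ereal r"
  shows "(\<lambda>k. lipschitz_minorant G k p) \<longlonglongrightarrow> r"
proof (rule order_tendstoI)
  fix a' assume "a' < r"
  then obtain a where a: "a' < a" "a < r" using dense by blast
  have "open {q. ereal a < G q}" using lsc by (simp add: lower_semicontinuous_def)
  moreover have "p \<in> {q. ereal a < G q}" using a r by simp
  ultimately obtain \<delta> where \<delta>: "\<delta> > 0" "ball p \<delta> \<subseteq> {q. ereal a < G q}"
    by (metis open_contains_ball)
  show "\<forall>\<^sub>F k in sequentially. a' < lipschitz_minorant G k p"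
  \<comment> \<open>\<open>k\<close> at least \<open>a\<close> prevents the truncation from cutting
    below \<open>a\<close> inside the ball; \<open>k * \<delta>\<close> at least
    \<open>a + C\<close> settles the points outside it.\<close>
  proof (rule eventually_sequentiallyI[of "nat \<lceil>max a ((a + C) / \<delta>)\<rceil>"])
    fix k assume "nat \<lceil>max a ((a + C) / \<delta>)\<rceil> \<le> k"
    then have k: "a \<le> real k" "(a + C) / \<delta> \<le> real k" by linarith+
    have "a \<le> real_of_ereal (min (G q) (ereal (real k))) + real k * dist p q" for q
    proof (cases "dist p q < \<delta>")
      case True
      then have "ereal a < G q" using \<delta> by auto
      then have "a \<le> real_of_ereal (min (G q) (ereal (real k)))"
        using k(1) by (cases "G q") (auto simp: min_def)
      then show ?thesis by (simp add: add_increasing2)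
    next
      case False
      then have "real k * \<delta> \<le> real k * dist p q" by (simp add: mult_left_mono)
      moreover have "a + C \<le> real k * \<delta>" using k(2) \<delta>(1) by (simp add: pos_divide_le_eq)
      ultimately show ?thesis using truncation_ge[of q k] by linarith
    qed
    then have "a \<le> lipschitz_minorant G k p"
      unfolding lipschitz_minorant_def by (intro cINF_greatest) auto
    then show "a' < lipschitz_minorant G k p" using a by simp
  qed
next
  fix a assume "r < a"
  then show "\<forall>\<^sub>F k in sequentially. lipschitz_minorant G k p < a"
    using lipschitz_minorant_le[of _ p] r
    by (intro always_eventually allI) (metis ereal_less_eq(3) le_less_trans)
qed

end

section \<open>Gibbs variational inequality\<close>

text \<open>Integrating the tangent inequality \<open>exp u \<ge> exp t * (1 + u - t)\<close> with
  \<open>u = - \<phi> - ln r\<close>, \<open>r\<close> the density of \<open>\<mu>\<close>, against \<open>\<mu>\<close> replaces Jensen's inequality.\<close>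

lemma gibbs_variational:
  assumes P: "prob_space P" and \<mu>: "prob_space \<mu>" and sets: "sets \<mu> = sets P"
    and ent: "relative_entropy \<mu> P < \<infinity>"
    and [measurable]: "\<Phi> \<in> borel_measurable P" and bnd: "\<And>x. - ereal c \<le> \<Phi> x"
    and \<phi>: "integrable \<mu> \<phi>" and eq: "AE x in \<mu>. \<Phi> x = ereal (\<phi> x)"
  shows "ennreal (exp (- (\<integral>x. \<phi> x \<partial>\<mu>) - real_of_ereal (relative_entropy \<mu> P)))
    \<le> (\<integral>\<^sup>+ x. exp_ereal (- \<Phi> x) \<partial>P)"
proof -
  interpret P: prob_space P by fact
  interpret \<mu>: prob_space \<mu> by fact
  have ac: "absolutely_continuous P \<mu>"
    using ent by (auto simp: relative_entropy_def split: if_splits)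
  define r where "r x = enn2real (RN_deriv P \<mu> x)" for x
  have r_meas [measurable]: "r \<in> borel_measurable P" and r_nn: "\<And>x. 0 \<le> r x"
    unfolding r_def by auto
  \<comment> \<open>\<open>enn2real\<close> alters the derivative only where it is infinite, which
    is a null set because \<open>\<mu>\<close> is sigma-finite.\<close>
  have "density P (\<lambda>x. ennreal (r x)) = density P (RN_deriv P \<mu>)"
    using P.RN_deriv_finite[OF \<mu>.sigma_finite_measure_axioms ac sets]
    by (intro density_cong) (auto simp: r_def ennreal_enn2real_if elim: eventually_mono)
  then have dens: "\<mu> = density P (\<lambda>x. ennreal (r x))"
    using P.density_RN_deriv[OF ac sets] by simp
  define s where "s x = r x * ln (r x)" for x
  have [measurable]: "s \<in> borel_measurable P" unfolding s_def by measurable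
  have s_ge: "- 1 \<le> s x" for x
  proof (cases "r x = 0")
    case False
    then have "0 < r x" using r_nn[of x] by simp
    moreover from this have "ln (inverse (r x)) \<le> inverse (r x) - 1"
      by (intro ln_le_minus_one) simp
    ultimately have "r x * (- ln (r x)) \<le> r x * (inverse (r x) - 1)"
      by (intro mult_left_mono) (auto simp: ln_inverse)
    then show ?thesis using \<open>0 < r x\<close> by (simp add: s_def right_diff_distrib)
  qed (simp add: s_def)
  have ent_eq: "relative_entropy \<mu> P = ereal_integral P (\<lambda>x. ereal (s x))"
    using ac by (simp add: relative_entropy_def s_def r_def)
  have s_int: "integrable P s" and D: "real_of_ereal (relative_entropy \<mu> P) = (\<integral>x. s x \<partial>P)"
    using ereal_integral_finite(2,3)[OF P, of "\<lambda>x. ereal (s x)" 1] s_ge ent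
    by (simp_all add: ent_eq one_ereal_def)
  \<comment> \<open>A real version of the integrand: the lower bound on \<open>\<Phi>\<close> bounds
    it by \<open>exp c\<close>, and it is 0 where \<open>\<Phi>\<close> is infinite.\<close>
  define X where "X x = enn2real (exp_ereal (- \<Phi> x))" for x
  have [measurable]: "X \<in> borel_measurable P" unfolding X_def by measurable
  have X_le: "exp_ereal (- \<Phi> x) \<le> ennreal (exp c)" for x
    using exp_ereal_mono[of "- \<Phi> x" "ereal c"] bnd[of x]
    by (simp add: ereal_uminus_le_reorder)
  then have X: "exp_ereal (- \<Phi> x) = ennreal (X x)" for x
    unfolding X_def by (metis ennreal_enn2real ennreal_less_top le_less_trans)
  have X_nn: "0 \<le> X x" for x by (simp add: X_def)
  have "X x \<le> exp c" for x using X_le[of x] by (simp add: X)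
  then have X_int: "integrable P X"
    using X_nn by (intro P.integrable_const_bound[of _ "exp c"]) auto
  have \<phi>_meas [measurable]: "\<phi> \<in> borel_measurable P"
    using borel_measurable_integrable[OF \<phi>] by (simp cong: measurable_cong_sets[OF sets refl])
  have r\<phi>: "integrable P (\<lambda>x. r x * \<phi> x)" "(\<integral>x. \<phi> x \<partial>\<mu>) = (\<integral>x. r x * \<phi> x \<partial>P)"
    using \<phi> r_nn by (simp_all add: dens integrable_density integral_density)
  have "integrable \<mu> (\<lambda>x. 1 :: real)" by simp
  then have r_int: "integrable P r"
    using r_nn by (simp add: dens integrable_density)
  have "(\<integral>x. 1 \<partial>\<mu>) = (\<integral>x. r x \<partial>P)"
    using r_nn by (subst dens, subst integral_density) auto
  then have r1: "(\<integral>x. r x \<partial>P) = 1" by (simp add: \<mu>.prob_space)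
  \<comment> \<open>The tangent point is the claimed exponent. With this choice
    \<open>(1 - t) * r - r * \<phi> - s\<close> has \<open>P\<close>-integral 1, so the minorant
    below integrates to exactly \<open>exp t\<close>.\<close>
  define t where "t = - (\<integral>x. \<phi> x \<partial>\<mu>) - real_of_ereal (relative_entropy \<mu> P)"
  have "AE x in P. 0 < ennreal (r x) \<longrightarrow> \<Phi> x = ereal (\<phi> x)"
    using eq unfolding dens by (subst (asm) AE_density) auto
  then have ae: "AE x in P. exp t * ((1 - t) * r x - r x * \<phi> x - s x) \<le> X x"
  proof eventually_elim
    case (elim x)
    \<comment> \<open>Where the density vanishes, the left side is 0 because
      \<open>0 * ln 0 = 0\<close>, and \<open>X\<close> is nonnegative; elsewhere the tangent
      inequality is multiplied by \<open>exp t * r x\<close>.\<close>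
    show ?case
    proof (cases "r x = 0")
      case False
      then have "0 < r x" using r_nn[of x] by simp
      then have "\<Phi> x = ereal (\<phi> x)" using elim by simp
      then have "X x = exp (- \<phi> x)" by (simp add: X_def)
      also have "\<dots> = exp t * r x * exp (- \<phi> x - ln (r x) - t)"
        using \<open>0 < r x\<close> by (simp add: exp_diff)
      finally have "X x = exp t * r x * exp (- \<phi> x - ln (r x) - t)" .
      moreover have "exp t * r x * (1 + (- \<phi> x - ln (r x) - t)) \<le> exp t * r x * exp (- \<phi> x - ln (r x) - t)"
        using r_nn[of x] by (intro mult_left_mono exp_ge_add_one_self) auto
      ultimately show ?thesis by (simp add: s_def algebra_simps)
    qed (simp add: s_def X_nn)
  qed
  have "(\<integral>x. exp t * ((1 - t) * r x - r x * \<phi> x - s x) \<partial>P) \<le> (\<integral>x. X x \<partial>P)"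
    by (rule integral_mono_AE[OF _ X_int ae]) (use r_int r\<phi>(1) s_int in auto)
  moreover have "(\<integral>x. exp t * ((1 - t) * r x - r x * \<phi> x - s x) \<partial>P) = exp t"
    using r_int r\<phi> s_int by (simp add: r1 D[symmetric] t_def)
  ultimately have "exp t \<le> (\<integral>x. X x \<partial>P)" by simp
  moreover have "(\<integral>\<^sup>+ x. exp_ereal (- \<Phi> x) \<partial>P) = ennreal (\<integral>x. X x \<partial>P)"
    unfolding X using X_int X_nn by (intro nn_integral_eq_integral) auto
  ultimately show ?thesis by (simp add: t_def ennreal_leI)
qed

section \<open>Potentials, Tonelli and the Gibbs exponent\<close>

text \<open>Up to the constant \<open>C\<close>, the potential is the inner integral of a
  nonnegative jointly measurable function.\<close>

lemma potential_measurable: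
  assumes \<nu>: "prob_space \<nu>" and \<mu>: "space \<mu> = UNIV"
    and G [measurable]: "G \<in> borel_measurable (\<mu> \<Otimes>\<^sub>M \<nu>)"
    and bnd: "\<And>p. - ereal C \<le> G p" and "0 \<le> C"
  shows "potential G \<nu> \<in> borel_measurable \<mu>"
    and "e2ennreal (potential G \<nu> x + ereal C) = (\<integral>\<^sup>+ y. e2ennreal (G (x, y) + ereal C) \<partial>\<nu>)"
    and "- ereal C \<le> potential G \<nu> x"
proof -
  interpret prob_space \<nu> by fact
  have sec: "(\<lambda>y. G (x, y)) \<in> borel_measurable \<nu>" for x
    using measurable_Pair2[OF G] \<mu> by auto
  note shift = ereal_integral_shift[OF \<nu> sec bnd \<open>0 \<le> C\<close>, folded potential_def]
  have "potential G \<nu> x = enn2ereal (\<integral>\<^sup>+ y. e2ennreal (G (x, y) + ereal C) \<partial>\<nu>) - ereal C" for x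
    using shift[of x] by (cases "potential G \<nu> x"; cases "enn2ereal (\<integral>\<^sup>+ y. e2ennreal (G (x, y) + ereal C) \<partial>\<nu>)") auto
  then have eq: "potential G \<nu> = (\<lambda>x. enn2ereal (\<integral>\<^sup>+ y. e2ennreal (G (x, y) + ereal C) \<partial>\<nu>) - ereal C)"
    by auto
  show "potential G \<nu> \<in> borel_measurable \<mu>" unfolding eq by measurable
  show "e2ennreal (potential G \<nu> x + ereal C) = (\<integral>\<^sup>+ y. e2ennreal (G (x, y) + ereal C) \<partial>\<nu>)"
    by (simp add: shift)
  show "- ereal C \<le> potential G \<nu> x"
    unfolding potential_def by (rule ereal_integral_lower_bound[OF \<nu> sec bnd \<open>0 \<le> C\<close>])
qed

text \<open>Tonelli for the shifted kernel; since both measures have mass 1, each side carries the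
  same finite constant \<open>C\<close>, which cancels.\<close>

lemma ereal_integral_swap:
  assumes \<mu>: "prob_space \<mu>" "space \<mu> = UNIV" and \<nu>: "prob_space \<nu>" "space \<nu> = UNIV"
    and G [measurable]: "G \<in> borel_measurable (\<mu> \<Otimes>\<^sub>M \<nu>)"
    and bnd: "\<And>p. - ereal C \<le> G p" and C: "0 \<le> C"
  shows "ereal_integral \<mu> (potential G \<nu>) = ereal_integral \<nu> (\<lambda>y. ereal_integral \<mu> (\<lambda>x. G (x, y)))"
proof -
  interpret pair_sigma_finite \<mu> \<nu>
    using \<mu>(1) \<nu>(1) by (simp add: pair_sigma_finite_def prob_space_imp_sigma_finite)
  define G' where "G' = (\<lambda>(y, x). G (x, y))"
  have G' [measurable]: "G' \<in> borel_measurable (\<nu> \<Otimes>\<^sub>M \<mu>)" unfolding G'_def by measurable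
  have bnd': "- ereal C \<le> G' p" for p using bnd by (cases p) (simp add: G'_def)
  have swap: "potential G' \<mu> = (\<lambda>y. ereal_integral \<mu> (\<lambda>x. G (x, y)))"
    by (simp add: potential_def G'_def fun_eq_iff)
  note pot = potential_measurable[OF \<nu>(1) \<mu>(2) G bnd C]
  note pot' = potential_measurable[OF \<mu>(1) \<nu>(2) G' bnd' C]
  have "ereal_integral \<mu> (potential G \<nu>) + ereal C
      = enn2ereal (\<integral>\<^sup>+ x. \<integral>\<^sup>+ y. e2ennreal (G (x, y) + ereal C) \<partial>\<nu> \<partial>\<mu>)"
    by (simp add: ereal_integral_shift[OF \<mu>(1) pot(1,3) C] pot(2))
  also have "\<dots> = enn2ereal (\<integral>\<^sup>+ y. \<integral>\<^sup>+ x. e2ennreal (G (x, y) + ereal C) \<partial>\<mu> \<partial>\<nu>)"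
    by (subst Fubini') simp_all
  also have "\<dots> = ereal_integral \<nu> (potential G' \<mu>) + ereal C"
    by (simp add: ereal_integral_shift[OF \<nu>(1) pot'(1,3) C] pot'(2)) (simp add: G'_def)
  finally show ?thesis
    unfolding swap
    by (cases "ereal_integral \<mu> (potential G \<nu>)"; cases "ereal_integral \<nu> (\<lambda>y. ereal_integral \<mu> (\<lambda>x. G (x, y)))") auto
qed

lemma exp_ereal_scale_shift:
  assumes "0 \<le> b"
  shows "exp_ereal (- (ereal b * u)) * ennreal (exp (- b * r)) = exp_ereal (- (ereal b * (ereal r + u)))"
\<comment> \<open>For \<open>b = 0\<close> and infinite \<open>u\<close> the convention
  \<open>0 * \<infinity> = 0\<close> makes both sides 1, unlike the case of positive
  \<open>b\<close>.\<close>
proof (cases "b = 0")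
  case False
  then show ?thesis using assms
    by (cases u) (auto simp: exp_ereal_def ennreal_top_mult mult_exp_exp algebra_simps simp flip: ennreal_mult)
qed (simp flip: zero_ereal_def)

section \<open>Uniform asymptotic lower bound for the potentials\<close>

text \<open>Near a given \<open>x\<close>, a Lipschitz minorant whose \<open>\<nu>\<close>-integral
  almost reaches \<open>V x\<close> gives the bound: weak convergence applies to it at
  \<open>x\<close>, and its Lipschitz constant and the continuity of \<open>V\<close> carry the
  estimate to nearby points. Compactness makes the threshold in \<open>n\<close> uniform.\<close>

lemma potential_eventually_ge:
  fixes G :: "'a::metric_space \<times> 'b::metric_space \<Rightarrow> ereal" and V :: "'a \<Rightarrow> real"
  assumes cpt: "compact (UNIV :: 'a set)" "compact (UNIV :: 'b set)"
    and lsc: "lower_semicontinuous G" and bnd: "\<And>p. - ereal C \<le> G p" and C: "0 \<le> C"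
    and \<nu>s: "\<And>n. \<nu>s n \<in> borel_prob" and \<nu>: "\<nu> \<in> borel_prob" and lim: "weakly_converges \<nu>s \<nu>"
    and V: "\<And>x. ereal (V x) = potential G \<nu> x" and V_cont: "continuous_on UNIV V"
    and e: "0 < e"
  shows "\<forall>\<^sub>F n in sequentially. \<forall>x. ereal (V x - e) \<le> potential G (\<nu>s n) x"
proof -
  interpret prob_space \<nu> using \<nu> by (simp add: borel_prob_def)
  define g where "g = lipschitz_minorant G"
  have g_cont: "continuous_on UNIV (\<lambda>y. g k (x, y))" for k x
    unfolding g_def
    by (intro continuous_on_compose2[OF continuous_on_lipschitz_minorant[OF bnd C, where A = UNIV]] continuous_intros) (use bnd C in auto)
  have g_int: "integrable \<kappa> (\<lambda>y. g k (x, y))" if "\<kappa> \<in> borel_prob" for \<kappa> k x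
    by (rule integrable_continuous_compact[OF cpt(2) that g_cont])
  have local: "\<exists>U. open U \<and> x \<in> U \<and>
      (\<forall>\<^sub>F n in sequentially. \<forall>x'\<in>U. ereal (V x' - e) \<le> potential G (\<nu>s n) x')" for x
  proof -
    define h where "h y = real_of_ereal (G (x, y))" for y
    have meas [measurable]: "(\<lambda>y. G (x, y)) \<in> borel_measurable \<nu>"
      using \<nu> by (intro lower_semicontinuous_measurable lower_semicontinuous_section lsc) (simp add: borel_prob_def)
    have "ereal_integral \<nu> (\<lambda>y. G (x, y)) < \<infinity>"
      unfolding potential_def[symmetric] V[symmetric] by simp
    note fin = ereal_integral_finite[OF prob_space_axioms meas bnd C this]
    have Vx: "V x = (\<integral>y. h y \<partial>\<nu>)"
      using fin(3) V[of x] by (simp add: potential_def h_def)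
    have "(\<lambda>k. \<integral>y. g k (x, y) \<partial>\<nu>) \<longlonglongrightarrow> (\<integral>y. h y \<partial>\<nu>)"
    \<comment> \<open>The minorants lie between \<open>- C\<close> and \<open>h\<close>, almost
      everywhere, which gives the dominating function.\<close>
    proof (rule integral_dominated_convergence[where w = "\<lambda>y. \<bar>h y\<bar> + C"])
      show "h \<in> borel_measurable \<nu>" unfolding h_def by measurable
      show "(\<lambda>y. g k (x, y)) \<in> borel_measurable \<nu>" for k
        using g_int[OF \<nu>] by (rule borel_measurable_integrable)
      have "integrable \<nu> h" using fin(2) unfolding h_def[abs_def] .
      then show "integrable \<nu> (\<lambda>y. \<bar>h y\<bar> + C)" by simp
      show "AE y in \<nu>. (\<lambda>k. g k (x, y)) \<longlonglongrightarrow> h y"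
        using fin(1) unfolding g_def h_def
        by eventually_elim (rule lipschitz_minorant_tendsto[OF bnd C lsc])
      show "AE y in \<nu>. norm (g k (x, y)) \<le> \<bar>h y\<bar> + C" for k
        using fin(1)
      proof eventually_elim
        case (elim y)
        have "ereal (g k (x, y)) \<le> ereal (h y)"
          using lipschitz_minorant_le[where G = G and k = k and p = "(x, y)", OF bnd C] elim by (simp add: g_def h_def)
        moreover have "- C \<le> g k (x, y)"
          unfolding g_def by (rule lipschitz_minorant_ge[OF bnd C])
        ultimately show ?case using C by auto
      qed
    qed
    then have "\<forall>\<^sub>F k in sequentially. V x - e / 4 < (\<integral>y. g k (x, y) \<partial>\<nu>)"
      using e unfolding Vx by (intro order_tendstoD(1)) auto
    then obtain k where k: "V x - e / 4 < (\<integral>y. g k (x, y) \<partial>\<nu>)"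
      using eventually_happens by fastforce
    \<comment> \<open>Three losses of \<open>e / 4\<close> occur: approximation at \<open>x\<close>,
      moving the minorant from \<open>x\<close> to \<open>x'\<close>, and the variation of
      \<open>V\<close>. Their sum is below \<open>e\<close>.\<close>
    define U where "U = {x'. real k * dist x' x < e / 4} \<inter> {x'. V x' < V x + e / 4}"
    have "open U"
      unfolding U_def by (intro open_Int open_Collect_less continuous_intros V_cont)
    moreover have "x \<in> U" using e by (simp add: U_def)
    moreover have "\<forall>\<^sub>F n in sequentially. \<forall>x'\<in>U. ereal (V x' - e) \<le> potential G (\<nu>s n) x'"
    proof -
      have "bounded (range (\<lambda>y. g k (x, y)))"
        by (intro compact_imp_bounded compact_continuous_image g_cont cpt)
      then have "(\<lambda>n. \<integral>y. g k (x, y) \<partial>\<nu>s n) \<longlonglongrightarrow> (\<integral>y. g k (x, y) \<partial>\<nu>)"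
        using lim g_cont[of k x] by (simp add: weakly_converges_def)
      then have "\<forall>\<^sub>F n in sequentially. V x - e / 4 < (\<integral>y. g k (x, y) \<partial>\<nu>s n)"
        using k by (rule order_tendstoD(1))
      then show ?thesis
      proof (eventually_elim, intro ballI)
        fix n x' assume n: "V x - e / 4 < (\<integral>y. g k (x, y) \<partial>\<nu>s n)" and "x' \<in> U"
        then have x': "real k * dist x' x < e / 4" "V x' < V x + e / 4" by (auto simp: U_def)
        interpret n: prob_space "\<nu>s n" using \<nu>s by (simp add: borel_prob_def)
        have "g k (x, y) - e / 4 \<le> g k (x', y)" for y
          using lipschitz_minorant_dist[where G = G and k = k and p = "(x, y)" and p' = "(x', y)", OF bnd C] x'(1)
          by (simp add: g_def dist_Pair_Pair dist_commute)
        then have "(\<integral>y. g k (x, y) - e / 4 \<partial>\<nu>s n) \<le> (\<integral>y. g k (x', y) \<partial>\<nu>s n)"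
          using g_int[OF \<nu>s] by (intro integral_mono) auto
        then have "V x' - e \<le> (\<integral>y. g k (x', y) \<partial>\<nu>s n)"
          using n x'(2) e g_int[OF \<nu>s[of n], of k x] by (simp add: n.prob_space)
        then have "ereal (V x' - e) \<le> ereal_integral (\<nu>s n) (\<lambda>y. ereal (g k (x', y)))"
          by (simp add: ereal_integral_eq_integral[OF g_int[OF \<nu>s]])
        also have "\<dots> \<le> potential G (\<nu>s n) x'"
          unfolding potential_def g_def by (intro ereal_integral_mono lipschitz_minorant_le[OF bnd C])
        finally show "ereal (V x' - e) \<le> potential G (\<nu>s n) x'" .
      qed
    qed
    ultimately show ?thesis by blast
  qed
  \<comment> \<open>The threshold in \<open>n\<close> depends on the open set; a finite subcover
    leaves finitely many thresholds to combine.\<close>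
  define \<U> where "\<U> = {U. open U \<and>
    (\<forall>\<^sub>F n in sequentially. \<forall>x\<in>U. ereal (V x - e) \<le> potential G (\<nu>s n) x)}"
  have "(UNIV :: 'a set) \<subseteq> \<Union>\<U>"
  proof
    fix x :: 'a
    show "x \<in> \<Union>\<U>" using local[of x] unfolding \<U>_def by blast
  qed
  moreover have "open U" if "U \<in> \<U>" for U using that by (simp add: \<U>_def)
  ultimately obtain F where F: "F \<subseteq> \<U>" "finite F" "(UNIV :: 'a set) \<subseteq> \<Union>F"
    by (rule compactE[OF cpt(1)])
  have "\<forall>\<^sub>F n in sequentially. \<forall>U\<in>F. \<forall>x\<in>U. ereal (V x - e) \<le> potential G (\<nu>s n) x"
    using F(1,2) by (intro eventually_ball_finite) (auto simp: \<U>_def)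
  then show ?thesis
    by (rule eventually_mono) (use F(3) in blast)
qed

section \<open>Laplace asymptotics of the Gibbs measures\<close>

theorem theorem4p2:
  fixes P :: "'n::metric_space measure"
    and GE :: "'n \<times> 'm::metric_space \<Rightarrow> ereal"
    and GI :: "'n \<Rightarrow> ereal"
    and \<nu>s :: "nat \<Rightarrow> 'm measure" and \<nu> :: "'m measure"
    and l \<beta> :: "nat \<Rightarrow> real"
    and V :: "'n \<Rightarrow> real"
    and f :: "'n \<Rightarrow> real"
  assumes compact_N: "compact (UNIV :: 'n set)"
    and compact_M: "compact (UNIV :: 'm set)"
    and P_prob: "P \<in> borel_prob"
    and GE_lsc: "lower_semicontinuous GE" and GE_gt: "\<And>x y. GE (x, y) > -\<infinity>"
    and GI_lsc: "lower_semicontinuous GI" and GI_gt: "\<And>x. GI x > -\<infinity>"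
    and \<nu>s: "\<And>n. \<nu>s n \<in> borel_prob" and \<nu>: "\<nu> \<in> borel_prob"
    and \<nu>s_lim: "weakly_converges \<nu>s \<nu>"
    and l_nonneg: "\<And>n. l n \<ge> 0" and l_lim: "l \<longlonglongrightarrow> 0"
    and V: "\<And>x. ereal (V x) = potential GE \<nu> x"
    and V_cont: "continuous_on UNIV V"
    and recovery: "\<And>z. \<exists>\<mu>s. (\<forall>n. \<mu>s n \<in> tilde_N P GE GI) \<and>
                            weakly_converges \<mu>s (return borel z)"
    and \<beta>_nonneg: "\<And>n. \<beta> n \<ge> 0" and \<beta>_lim: "filterlim \<beta> at_top sequentially"
    and f_cont: "continuous_on UNIV f"
  shows "(\<lambda>n. ereal (1 / \<beta> n) *
            ln_ennreal (\<integral>\<^sup>+ x. ennreal (exp (- \<beta> n * f x))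
                          \<partial>gibbs_measure P (\<beta> n) (potential GE (\<nu>s n)) (l n) GI))
         \<longlonglongrightarrow> ereal (- (INF x. f x + V x))"
proof -
  define m where "m = (INF x. f x + V x)"
  have fV_cont: "continuous_on UNIV (\<lambda>x. f x + V x)"
    by (intro continuous_intros f_cont V_cont)
  obtain z where z: "\<And>x. f z + V z \<le> f x + V x"
    using continuous_attains_inf[OF compact_N _ fV_cont] by auto
  have m: "m = f z + V z"
    unfolding m_def using z by (intro cInf_eq_minimum) auto
  obtain CE where CE: "0 \<le> CE" "\<And>p. - ereal CE \<le> GE p"
    using lower_semicontinuous_bounded_below[OF compact_Times[OF compact_N compact_M, unfolded UNIV_Times_UNIV] GE_lsc] GE_gt
    by (metis surj_pair)
  obtain CI where CI: "0 \<le> CI" "\<And>x. - ereal CI \<le> GI x"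
    using lower_semicontinuous_bounded_below[OF compact_N GI_lsc GI_gt] by blast
  have spaceI: "space \<kappa> = UNIV" if "\<kappa> \<in> borel_prob" for \<kappa> :: "'x::topological_space measure"
    using that sets_eq_imp_space_eq[of \<kappa> borel] by (simp add: borel_prob_def)
  have prob: "prob_space \<kappa>" if "\<kappa> \<in> borel_prob" for \<kappa> :: "'x::topological_space measure"
    using that by (simp add: borel_prob_def)
  have GE_meas: "GE \<in> borel_measurable (\<mu> \<Otimes>\<^sub>M \<kappa>)" if "\<mu> \<in> borel_prob" "\<kappa> \<in> borel_prob" for \<mu> \<kappa>
    using lower_semicontinuous_measurable_pair[OF compact_N compact_M GE_lsc] that
      measurable_cong_sets[OF sets_pair_measure_cong[of \<mu> borel \<kappa> borel] refl]
    by (auto simp: borel_prob_def)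
  have GI_meas: "GI \<in> borel_measurable \<mu>" if "\<mu> \<in> borel_prob" for \<mu>
    using that by (intro lower_semicontinuous_measurable[OF GI_lsc]) (simp add: borel_prob_def)
  define W where "W n = potential GE (\<nu>s n)" for n
  have W_meas: "W n \<in> borel_measurable \<mu>" if "\<mu> \<in> borel_prob" for n \<mu>
    unfolding W_def
    by (rule potential_measurable(1)[OF prob[OF \<nu>s] spaceI[OF that] GE_meas[OF that \<nu>s] CE(2,1)])
  have W_ge: "- ereal CE \<le> W n x" for n x
    unfolding W_def
    by (rule potential_measurable(3)[OF prob[OF \<nu>s] spaceI[OF P_prob] GE_meas[OF P_prob \<nu>s] CE(2,1)])
  \<comment> \<open>The total energy: the weight from \<open>f\<close> is absorbed into the Gibbs
    density, so that a single exponential is integrated against \<open>P\<close>.\<close>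
  define H where "H n x = ereal (f x) + (W n x + ereal (l n) * GI x)" for n x
  define Z where "Z n = (\<integral>\<^sup>+ x. exp_ereal (- (ereal (\<beta> n) * H n x)) \<partial>P)" for n
  have f_meas: "f \<in> borel_measurable \<mu>" if "\<mu> \<in> borel_prob" for \<mu>
    using borel_measurable_continuous_onI[OF f_cont] that
    by (simp add: borel_prob_def cong: measurable_cong_sets)
  note [measurable] = W_meas[OF P_prob] GI_meas[OF P_prob] f_meas[OF P_prob]
  have H_meas [measurable]: "H n \<in> borel_measurable P" for n
    unfolding H_def by measurable
  have Z: "(\<integral>\<^sup>+ x. ennreal (exp (- \<beta> n * f x)) \<partial>gibbs_measure P (\<beta> n) (W n) (l n) GI) = Z n" for n
  proof -
    have "(\<integral>\<^sup>+ x. ennreal (exp (- \<beta> n * f x)) \<partial>gibbs_measure P (\<beta> n) (W n) (l n) GI)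
        = (\<integral>\<^sup>+ x. exp_ereal (- (ereal (\<beta> n) * (W n x + ereal (l n) * GI x))) * ennreal (exp (- \<beta> n * f x)) \<partial>P)"
      unfolding gibbs_measure_def by (intro nn_integral_density) measurable
    then show ?thesis
      by (simp only: exp_ereal_scale_shift[OF \<beta>_nonneg] Z_def H_def)
  qed
  have lGI_ge: "ereal (- (l n * CI)) \<le> ereal (l n) * GI x" for n x
    using ereal_mult_left_mono[OF CI(2)[of x], of "ereal (l n)"] l_nonneg[of n] by simp
  \<comment> \<open>Terms with \<open>\<beta> n = 0\<close> have prefactor 0 by the convention
    \<open>1 / 0 = 0\<close>; only finitely many such \<open>n\<close> exist.\<close>
  have \<beta>_pos: "\<forall>\<^sub>F n in sequentially. 0 < \<beta> n"
    using \<beta>_lim by (simp add: filterlim_at_top_dense)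
  \<comment> \<open>One \<open>e\<close> pays for replacing the potentials by \<open>V\<close>, the
    other for the negative part of \<open>l n * GI\<close>, at most \<open>l n * CI\<close>.\<close>
  have upper: "\<forall>\<^sub>F n in sequentially. ereal (1 / \<beta> n) * ln_ennreal (Z n) \<le> ereal (- (m - 2 * e))"
    if e: "0 < e" for e
  proof -
    have "(\<lambda>n. l n * CI) \<longlonglongrightarrow> 0 * CI" by (intro tendsto_intros l_lim)
    then have "\<forall>\<^sub>F n in sequentially. l n * CI < e"
      using e by (intro order_tendstoD(2)) auto
    moreover have "\<forall>\<^sub>F n in sequentially. \<forall>x. ereal (V x - e) \<le> W n x"
      unfolding W_def
      by (rule potential_eventually_ge[OF compact_N compact_M GE_lsc CE(2,1) \<nu>s \<nu> \<nu>s_lim V V_cont e])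
    ultimately show ?thesis
      using \<beta>_pos
    proof eventually_elim
      case (elim n)
      interpret P: prob_space P by (rule prob[OF P_prob])
      have "exp_ereal (- (ereal (\<beta> n) * H n x)) \<le> ennreal (exp (- (\<beta> n * (m - 2 * e))))" for x
      proof -
        have "ereal (m - 2 * e) \<le> ereal (f x) + (ereal (V x - e) + ereal (- (l n * CI)))"
          using z[of x] elim(1) by (simp add: m)
        also have "\<dots> \<le> H n x"
          unfolding H_def using elim(2) lGI_ge by (intro add_mono order_refl) auto
        finally have "ereal (\<beta> n) * ereal (m - 2 * e) \<le> ereal (\<beta> n) * H n x"
          using \<beta>_nonneg by (intro ereal_mult_left_mono) auto
        then have "- (ereal (\<beta> n) * H n x) \<le> ereal (- (\<beta> n * (m - 2 * e)))"
          by (cases "ereal (\<beta> n) * H n x") auto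
        then show ?thesis using exp_ereal_mono exp_ereal_ereal by metis
      qed
      then have "Z n \<le> (\<integral>\<^sup>+ x. ennreal (exp (- (\<beta> n * (m - 2 * e)))) \<partial>P)"
        unfolding Z_def by (rule nn_integral_mono)
      then have "Z n \<le> ennreal (exp (- (\<beta> n * (m - 2 * e))))"
        by (simp add: P.emeasure_space_1)
      then have "ereal (1 / \<beta> n) * ln_ennreal (Z n) \<le> ereal (1 / \<beta> n) * ereal (- (\<beta> n * (m - 2 * e)))"
        using \<beta>_nonneg by (intro ereal_mult_left_mono ln_ennreal_le) auto
      then show ?case using elim(3) by simp
    qed
  qed
  have lower: "\<forall>\<^sub>F n in sequentially. ereal (- (m + e)) \<le> ereal (1 / \<beta> n) * ln_ennreal (Z n)"
    if e: "0 < e" for e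
  proof -
    obtain \<mu>s where \<mu>s: "\<And>k. \<mu>s k \<in> tilde_N P GE GI" "weakly_converges \<mu>s (return borel z)"
      using recovery[of z] by blast
    have "bounded (range (\<lambda>x. f x + V x))"
      by (intro compact_imp_bounded compact_continuous_image fV_cont compact_N)
    then have "(\<lambda>k. \<integral>x. f x + V x \<partial>\<mu>s k) \<longlonglongrightarrow> (\<integral>x. f x + V x \<partial>return borel z)"
      using \<mu>s(2) fV_cont by (simp add: weakly_converges_def)
    also have "(\<integral>x. f x + V x \<partial>return borel z) = m"
      using borel_measurable_continuous_onI[OF fV_cont] by (simp add: integral_return m)
    finally have "\<forall>\<^sub>F k in sequentially. (\<integral>x. f x + V x \<partial>\<mu>s k) < m + e"
      using e by (intro order_tendstoD(2)) auto
    \<comment> \<open>The test measure is fixed here, before \<open>n\<close> grows, so its entropy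
      and its integral of \<open>GI\<close> are constants in the limit.\<close>
    then obtain k where k: "(\<integral>x. f x + V x \<partial>\<mu>s k) < m + e"
      using eventually_happens by fastforce
    define \<mu> where "\<mu> = \<mu>s k"
    from \<mu>s(1)[of k] obtain h where \<mu>: "\<mu> \<in> borel_prob" and ent: "relative_entropy \<mu> P < \<infinity>"
      and GI_fin: "ereal_integral \<mu> GI < \<infinity>" and h_cont: "continuous_on UNIV h"
      and h: "\<And>y. ereal_integral \<mu> (\<lambda>x. GE (x, y)) = ereal (h y)"
      by (auto simp: tilde_N_def \<mu>_def)
    define D where "D = real_of_ereal (relative_entropy \<mu> P)"
    note GI_int = ereal_integral_finite[OF prob[OF \<mu>] GI_meas[OF \<mu>] CI(2,1) GI_fin]
    have f_int: "integrable \<mu> f" and V_int: "integrable \<mu> V"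
      by (rule integrable_continuous_compact[OF compact_N \<mu>] f_cont V_cont)+
    have h_int: "integrable \<kappa> h" if "\<kappa> \<in> borel_prob" for \<kappa>
      by (rule integrable_continuous_compact[OF compact_M that h_cont])
    \<comment> \<open>Applied to each \<open>\<nu>s n\<close> and to \<open>\<nu>\<close>, this
      turns the integrals of the potentials against \<open>\<mu>\<close> into integrals of one
      continuous \<open>h\<close>, where weak convergence applies.\<close>
    have swap: "ereal_integral \<mu> (potential GE \<kappa>) = ereal (\<integral>y. h y \<partial>\<kappa>)" if "\<kappa> \<in> borel_prob" for \<kappa>
      using ereal_integral_swap[OF prob[OF \<mu>] spaceI[OF \<mu>] prob[OF that] spaceI[OF that] GE_meas[OF \<mu> that] CE(2,1)]
      by (simp add: h ereal_integral_eq_integral[OF h_int[OF that]])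
    have "potential GE \<nu> = (\<lambda>x. ereal (V x))" using V by auto
    then have hV: "(\<integral>y. h y \<partial>\<nu>) = (\<integral>x. V x \<partial>\<mu>)"
      using swap[OF \<nu>] by (simp add: ereal_integral_eq_integral[OF V_int])
    \<comment> \<open>Although \<open>W n\<close> may take the value \<infinity>, its
      \<open>\<mu>\<close>-integral is the real number obtained by integrating \<open>h\<close>, so
      those points are \<open>\<mu>\<close>-null.\<close>
    have W_fin: "ereal_integral \<mu> (W n) < \<infinity>" for n
      unfolding W_def swap[OF \<nu>s] by simp
    note W_int = ereal_integral_finite[OF prob[OF \<mu>] W_meas[OF \<mu>] W_ge CE(1) W_fin]
    have hW: "(\<integral>x. real_of_ereal (W n x) \<partial>\<mu>) = (\<integral>y. h y \<partial>\<nu>s n)" for n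
      using W_int(3)[of n] swap[OF \<nu>s, of n] by (simp add: W_def)
    define \<phi> where "\<phi> n x = f x + (real_of_ereal (W n x) + l n * real_of_ereal (GI x))" for n x
    have \<phi>_int: "integrable \<mu> (\<phi> n)" for n
      unfolding \<phi>_def using f_int W_int(2) GI_int(2) by auto
    \<comment> \<open>\<open>- a n\<close> is the variational lower bound divided by
      \<open>\<beta> n\<close>. The entropy term vanishes as \<open>\<beta> n\<close> grows and the
      \<open>GI\<close> term as \<open>l n\<close> tends to 0, leaving the
      \<open>\<mu>\<close>-integral of \<open>f + V\<close>.\<close>
    define a where "a n = (\<integral>x. \<phi> n x \<partial>\<mu>) + D / \<beta> n" for n
    have a_eq: "a n = (\<integral>x. f x \<partial>\<mu>) + ((\<integral>y. h y \<partial>\<nu>s n) + l n * (\<integral>x. real_of_ereal (GI x) \<partial>\<mu>)) + D / \<beta> n" for n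
      unfolding a_def \<phi>_def using f_int W_int(2) GI_int(2) by (simp add: hW)
    have "bounded (range h)"
      by (intro compact_imp_bounded compact_continuous_image h_cont compact_M)
    then have "(\<lambda>n. \<integral>y. h y \<partial>\<nu>s n) \<longlonglongrightarrow> (\<integral>y. h y \<partial>\<nu>)"
      using \<nu>s_lim h_cont by (simp add: weakly_converges_def)
    then have "a \<longlonglongrightarrow> (\<integral>x. f x \<partial>\<mu>) + ((\<integral>y. h y \<partial>\<nu>) + 0 * (\<integral>x. real_of_ereal (GI x) \<partial>\<mu>)) + 0"
      unfolding a_eq[abs_def]
      by (intro tendsto_intros l_lim real_tendsto_divide_at_top[OF tendsto_const \<beta>_lim])
    moreover have "(\<integral>x. f x \<partial>\<mu>) + ((\<integral>y. h y \<partial>\<nu>) + 0 * (\<integral>x. real_of_ereal (GI x) \<partial>\<mu>)) + 0 < m + e"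
      using k f_int V_int by (simp add: hV flip: \<mu>_def)
    ultimately have "\<forall>\<^sub>F n in sequentially. a n < m + e"
      by (rule order_tendstoD(2))
    then show ?thesis
      using \<beta>_pos
    proof eventually_elim
      case (elim n)
      have "bounded (range f)"
        by (intro compact_imp_bounded compact_continuous_image f_cont compact_N)
      then obtain B where B: "\<And>x. \<bar>f x\<bar> \<le> B" by (auto simp: bounded_iff)
      \<comment> \<open>The variational inequality needs some lower bound on the exponent for each
        fixed \<open>n\<close>; its dependence on \<open>n\<close> does not enter the
        estimate.\<close>
      have H_ge: "- ereal (\<beta> n * (B + CE + l n * CI)) \<le> ereal (\<beta> n) * H n x" for x
      proof -
        have "ereal (- B) + (ereal (- CE) + ereal (- (l n * CI))) \<le> H n x"
          unfolding H_def using B[of x] W_ge[of n x] lGI_ge by (intro add_mono) auto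
        then have "ereal (\<beta> n) * (ereal (- B) + (ereal (- CE) + ereal (- (l n * CI)))) \<le> ereal (\<beta> n) * H n x"
          using \<beta>_nonneg by (intro ereal_mult_left_mono) auto
        then show ?thesis by (simp add: algebra_simps)
      qed
      have eq: "AE x in \<mu>. ereal (\<beta> n) * H n x = ereal (\<beta> n * \<phi> n x)"
        using W_int(1)[of n] GI_int(1)
      proof eventually_elim
        case (elim x)
        show ?case unfolding H_def \<phi>_def by (subst elim(1), subst elim(2)) simp
      qed
      have "ennreal (exp (- (\<integral>x. \<beta> n * \<phi> n x \<partial>\<mu>) - D)) \<le> Z n"
        unfolding Z_def D_def
        using \<mu> P_prob \<phi>_int
        by (intro gibbs_variational[OF prob[OF P_prob] prob[OF \<mu>] _ ent _ H_ge _ eq])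
          (auto simp: borel_prob_def)
      then have "ereal (1 / \<beta> n) * ereal (- (\<integral>x. \<beta> n * \<phi> n x \<partial>\<mu>) - D) \<le> ereal (1 / \<beta> n) * ln_ennreal (Z n)"
        using \<beta>_nonneg by (intro ereal_mult_left_mono ln_ennreal_ge) auto
      moreover have "(1 / \<beta> n) * (- (\<integral>x. \<beta> n * \<phi> n x \<partial>\<mu>) - D) = - a n"
        using elim(2) by (simp add: a_def field_simps)
      ultimately have "ereal (- a n) \<le> ereal (1 / \<beta> n) * ln_ennreal (Z n)"
        by (metis times_ereal.simps(1))
      moreover have "ereal (- (m + e)) \<le> ereal (- a n)" using elim(1) by simp
      ultimately show ?case by (rule order_trans[rotated])
    qed
  qed
  have "(\<lambda>n. ereal (1 / \<beta> n) * ln_ennreal (Z n)) \<longlonglongrightarrow> ereal (- m)"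
  proof (rule order_tendstoI)
    fix a assume "a < ereal (- m)"
    then obtain r where r: "a < ereal r" "ereal r < ereal (- m)" using ereal_dense2 by blast
    \<comment> \<open>With \<open>e = - m - r\<close> the lower bound \<open>- (m + e)\<close>
      equals \<open>r\<close>.\<close>
    then have "0 < - m - r" by simp
    from lower[OF this] show "\<forall>\<^sub>F n in sequentially. a < ereal (1 / \<beta> n) * ln_ennreal (Z n)"
      by (rule eventually_mono) (use r(1) in auto)
  next
    fix a assume "ereal (- m) < a"
    then obtain r where r: "ereal (- m) < ereal r" "ereal r < a" using ereal_dense2 by blast
    \<comment> \<open>Chosen so that the upper bound \<open>- (m - 2 * e)\<close> equals
      \<open>r\<close>.\<close>
    define e where "e = (r + m) / 2"
    have "0 < e" "- (m - 2 * e) = r" using r(1) by (simp_all add: e_def field_simps)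
    with upper[of e] have "\<forall>\<^sub>F n in sequentially. ereal (1 / \<beta> n) * ln_ennreal (Z n) \<le> ereal r" by simp
    then show "\<forall>\<^sub>F n in sequentially. ereal (1 / \<beta> n) * ln_ennreal (Z n) < a"
      by (rule eventually_mono) (use r(2) in auto)
  qed
  then show ?thesis unfolding m_def[symmetric] W_def[symmetric] Z .
qed

end
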